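(* Let $A$ be a $C^*$-algebra, and let $a, b\in A$ be regular elements such that $ab$ is also regular. Define $p = bb^{\dagger}$, $q = a^{\dagger}(a^{\dagger})^{*}$, $r = bb^*$ and $s = a^{\dagger}a$. Then the following statements are equivalent: (i) $(ab)^{\dagger} = b^{\dagger}a^{\dagger}$; (ii) $b^*(q^{\dagger}p-pq^{\dagger})a^{\dagger}=0$ and $b^*(sr^{\dagger}-r^{\dagger}s)a^{\dagger}=0$; (iii) $pq^{\dagger}ps = pq^{\dagger}$ and $psr^{\dagger}s = r^{\dagger}s$.
   Context: An element $a$ of a $C^*$-algebra $A$ is called regular if there is $a'\in A$ with $a = aa'a$. Every regular element $a$ of a $C^*$-algebra has a unique Moore-Penrose inverse, denoted $a^{\dagger}$: the unique $x\in A$ with $a=axa$, $x=xax$, $(ax)^*=ax$, $(xa)^*=xa$. If $a$ and $b$ are regular, then $a^{\dagger}(a^{\dagger})^{*}$ and $bb^*$ are also regular, so $q^{\dagger}$ and $r^{\dagger}$ in the statement exist. *)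

theory Defs
  imports Complex_Main
begin

text \<open>
  C*-algebras, not necessarily unital. The class extends the library's real Banach algebras
  (without unit) by a complex scalar multiplication that restricts to the given real one,
  and by an involution satisfying the C*-identity.
\<close>

class cstar_algebra = real_normed_algebra + banach +
  fixes scaleC :: "complex \<Rightarrow> 'a \<Rightarrow> 'a"  (infixr \<open>*\<^sub>C\<close> 75)
    and star :: "'a \<Rightarrow> 'a"
  assumes scaleC_of_real: "complex_of_real t *\<^sub>C x = t *\<^sub>R x"
    and scaleC_add_right: "c *\<^sub>C (x + y) = c *\<^sub>C x + c *\<^sub>C y"
    and scaleC_add_left: "(c + d) *\<^sub>C x = c *\<^sub>C x + d *\<^sub>C x"
    and scaleC_scaleC: "c *\<^sub>C d *\<^sub>C x = (c * d) *\<^sub>C x"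
    and mult_scaleC_left: "(c *\<^sub>C x) * y = c *\<^sub>C (x * y)"
    and mult_scaleC_right: "x * (c *\<^sub>C y) = c *\<^sub>C (x * y)"
    and norm_scaleC: "norm (c *\<^sub>C x) = cmod c * norm x"
    and star_add: "star (x + y) = star x + star y"
    and star_scaleC: "star (c *\<^sub>C x) = cnj c *\<^sub>C star x"
    and star_mult: "star (x * y) = star y * star x"
    and star_star: "star (star x) = x"
    and cstar_identity: "norm (star x * x) = (norm x)\<^sup>2"

definition regular_element :: "'a::cstar_algebra \<Rightarrow> bool" where
  "regular_element a \<longleftrightarrow> (\<exists>a'. a = a * a' * a)"

definition is_mp_inverse :: "'a::cstar_algebra \<Rightarrow> 'a \<Rightarrow> bool" where
  "is_mp_inverse a x \<longleftrightarrow>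
     a = a * x * a \<and> x = x * a * x \<and> star (a * x) = a * x \<and> star (x * a) = x * a"

text \<open>Meaningful only for regular arguments, where the Moore-Penrose inverse exists.\<close>

definition mp_inverse :: "'a::cstar_algebra \<Rightarrow> 'a" where
  "mp_inverse a = (THE x. is_mp_inverse a x)"

lemma is_mp_inverse_unique:
  assumes "is_mp_inverse a x" and "is_mp_inverse a y"
  shows "x = y"
proof -
  have x: "a * x * a = a" "x * a * x = x" "star (a * x) = a * x" "star (x * a) = x * a"
    and y: "a * y * a = a" "y * a * y = y" "star (a * y) = a * y" "star (y * a) = y * a"
    using assms unfolding is_mp_inverse_def by simp_all
  have "a * x = star (a * y * (a * x))"
    using x(3) y(1) by (simp flip: mult.assoc)
  also have "\<dots> = a * x * (a * y)"
    by (simp only: star_mult[of "a * y"] x(3) y(3))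
  also have "\<dots> = a * y"
    using x(1) by (simp flip: mult.assoc)
  finally have ax: "a * x = a * y" .
  have "x * a = star (x * a * (y * a))"
    using x(4) y(1) by (simp add: mult.assoc)
  also have "\<dots> = y * a * (x * a)"
    by (simp only: star_mult[of "x * a"] x(4) y(4))
  also have "\<dots> = y * a"
    using x(1) by (simp add: mult.assoc)
  finally have xa: "x * a = y * a" .
  have "x = x * a * x" using x(2) by simp
  also have "\<dots> = y * (a * x)" by (simp add: xa mult.assoc)
  also have "\<dots> = y" using y(2) by (simp add: ax mult.assoc)
  finally show ?thesis .
qed

lemma mp_inverse_eqI: "is_mp_inverse a x \<Longrightarrow> mp_inverse a = x"
  unfolding mp_inverse_def by (blast intro: is_mp_inverse_unique)

end

theory Submission
  imports Defs "HOL-Analysis.Elementary_Metric_Spaces"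
begin

text \<open>
  Write \<open>c = a\<^sup>* a\<close> and \<open>d = (b\<^sup>\<dagger>)\<^sup>* b\<^sup>\<dagger>\<close>. Since \<open>x x\<^sup>*\<close> and \<open>a\<^sup>* a\<close> are Moore-Penrose inverse to each
  other whenever \<open>a\<close> and \<open>x\<close> are, \<open>q\<^sup>\<dagger> = c\<close> and \<open>r\<^sup>\<dagger> = d\<close>. Everything is compared with Greville's
  condition that the projection \<open>p = b b\<^sup>\<dagger>\<close> commutes with \<open>c\<close> and the projection \<open>s = a\<^sup>\<dagger> a\<close> with \<open>d\<close>.

  Conditions (ii) and (iii) differ only by multiplication with factors that can be cancelled: each
  equation of (ii), multiplied by \<open>(b\<^sup>\<dagger>)\<^sup>*\<close> on the left and by \<open>a\<close> on the right, becomes the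
  corresponding equation of (iii), and \<open>b\<^sup>*\<close> and \<open>a\<^sup>\<dagger>\<close> lead back.

  Both (i) and (iii) look weaker than Greville's condition. In each of them the missing
  information is that \<open>s\<close> and \<open>p\<close> commute. This is where the C*-identity enters: the projections commute
  as soon as the compression \<open>s p s\<close> is idempotent, because then
  \<open>((1 - s) p s)\<^sup>* ((1 - s) p s) = s p s - (s p s)\<^sup>2 = 0\<close>. In (i) idempotency comes from
  \<open>a b b\<^sup>\<dagger> a\<^sup>\<dagger> a b = a b\<close>. In (iii) the first equation gives \<open>z c z = c z\<close> for \<open>z = s p s\<close>, so
  \<open>c\<close> commutes with \<open>z\<close> by taking adjoints and \<open>c z\<^sup>2 = c z\<close>; as \<open>c\<close> is invertible relative to \<open>s\<close>,
  \<open>z\<^sup>2 = z\<close>.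

  To extract from (i) that \<open>b\<^sup>\<dagger> a\<^sup>\<dagger>\<close> satisfies the four Penrose equations, one needs that
  regular elements really have Moore-Penrose inverses. This amounts to replacing an idempotent \<open>e\<close> by a
  projection with the same right ideal, namely \<open>e e\<^sup>* w\<^sup>-\<^sup>1\<close> with \<open>w = 1 - (e - e\<^sup>*)\<^sup>2 = 1 + k\<^sup>2\<close> for
  the self-adjoint \<open>k = \<i> (e - e\<^sup>*)\<close>. Here \<open>1 + k\<^sup>2 = (k - \<i>) (k + \<i>)\<close> is invertible, since
  the spectrum of a self-adjoint element is real. The algebra may lack a unit, so \<open>k \<plusminus> \<i>\<close> and \<open>w\<close> are
  treated as operators on it, inverted by Banach's fixed point theorem.
\<close>

section \<open>The involution\<close>

lemma star_zero [simp]: "star (0::'a::cstar_algebra) = 0"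
  using star_add[of "0::'a" 0] by simp

lemma star_minus: "star (- x) = - star (x::'a::cstar_algebra)"
  using star_add[of x "- x"] by (simp add: eq_neg_iff_add_eq_0 add.commute)

lemma star_diff: "star (x - y) = star x - star (y::'a::cstar_algebra)"
  using star_add[of x "- y"] by (simp add: star_minus)

lemma star_mult_self_eq_zero_iff: "star x * x = 0 \<longleftrightarrow> x = (0::'a::cstar_algebra)"
  using cstar_identity[of x] by auto

lemma scaleC_one [simp]: "1 *\<^sub>C x = (x::'a::cstar_algebra)"
  using scaleC_of_real[of 1 x] by simp

lemma scaleC_minus_one: "(- 1) *\<^sub>C x = - (x::'a::cstar_algebra)"
  using scaleC_of_real[of "- 1" x] by simp

lemma scaleC_minus_right: "c *\<^sub>C (- x) = - (c *\<^sub>C (x::'a::cstar_algebra))"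
  using scaleC_scaleC[of c "- 1" x] scaleC_scaleC[of "- 1" c x] by (simp add: scaleC_minus_one)

lemma scaleC_diff_right: "c *\<^sub>C (x - y) = c *\<^sub>C x - c *\<^sub>C (y::'a::cstar_algebra)"
  using scaleC_add_right[of c x "- y"] by (simp add: scaleC_minus_right)

section \<open>Inverting \<open>1 + k\<^sup>2\<close> for self-adjoint \<open>k\<close>\<close>

text \<open>
  The cross terms of \<open>(k x + \<i> t x)\<^sup>* (k x + \<i> t x)\<close> cancel when \<open>k\<close> is self-adjoint and \<open>t\<close> real.
\<close>

lemma norm_selfadjoint_plus_imaginary:
  fixes k x :: "'a::cstar_algebra"
  assumes "star k = k"
  shows "(norm (k * x + (\<i> * complex_of_real t) *\<^sub>C x))\<^sup>2 \<le> ((norm k)\<^sup>2 + t\<^sup>2) * (norm x)\<^sup>2"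
proof -
  define c where "c = \<i> * complex_of_real t"
  have c: "cnj c + c = 0" "cnj c * c = complex_of_real (t\<^sup>2)"
    by (simp_all add: c_def power2_eq_square) (simp add: algebra_simps flip: power2_eq_square)
  let ?u = "k * x + c *\<^sub>C x"
  have "star ?u * ?u = star (k * x) * (k * x) + (cnj c + c) *\<^sub>C (star x * (k * x))
      + (cnj c * c) *\<^sub>C (star x * x)"
    unfolding scaleC_add_left scaleC_scaleC[symmetric]
    by (simp add: star_add star_scaleC star_mult assms algebra_simps mult_scaleC_left
        mult_scaleC_right scaleC_add_right)
      (simp add: scaleC_scaleC mult.commute)
  also have "\<dots> = star (k * x) * (k * x) + t\<^sup>2 *\<^sub>R (star x * x)"
    unfolding c scaleC_of_real using scaleC_of_real[of 0] by simp
  finally have "(norm ?u)\<^sup>2 = norm (star (k * x) * (k * x) + t\<^sup>2 *\<^sub>R (star x * x))"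
    by (simp flip: cstar_identity)
  also have "\<dots> \<le> norm (star (k * x) * (k * x)) + norm (t\<^sup>2 *\<^sub>R (star x * x))"
    by (rule norm_triangle_ineq)
  also have "\<dots> = (norm (k * x))\<^sup>2 + t\<^sup>2 * (norm x)\<^sup>2"
    by (simp add: cstar_identity)
  also have "\<dots> \<le> (norm k * norm x)\<^sup>2 + t\<^sup>2 * (norm x)\<^sup>2"
    by (intro add_right_mono power_mono norm_mult_ineq norm_ge_zero)
  finally show ?thesis
    by (simp add: c_def power_mult_distrib distrib_right)
qed

text \<open>
  For real \<open>t \<ge> 0\<close>, the equation says that \<open>x\<close> is a fixed point of
  \<open>x \<mapsto> ((k + \<i> t) x - y) / (\<i> (1 + t))\<close>, whose Lipschitz constant is at most
  \<open>sqrt (norm k ^ 2 + t ^ 2) / (1 + t)\<close>. This is less than \<open>1\<close> for large \<open>t\<close>, for instance when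
  \<open>t = norm k ^ 2\<close>.
\<close>

lemma ex1_selfadjoint_minus_ii:
  fixes k y :: "'a::cstar_algebra"
  assumes "star k = k"
  shows "\<exists>!x. k * x - \<i> *\<^sub>C x = y"
proof -
  define t where "t = (norm k)\<^sup>2"
  have t: "t \<ge> 0" by (simp add: t_def)
  define m where "m = sqrt (t + t\<^sup>2) / (1 + t)"
  define f where "f x = (- \<i> / complex_of_real (1 + t)) *\<^sub>C
    (k * x + (\<i> * complex_of_real t) *\<^sub>C x - y)" for x
  have "t + t\<^sup>2 < (1 + t)\<^sup>2"
    using t by (simp add: power2_eq_square algebra_simps)
  then have m: "0 \<le> m" "m < 1"
    using t by (auto simp: m_def real_sqrt_less_iff intro: real_less_lsqrt)
  have t_nz: "complex_of_real (1 + t) \<noteq> 0"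
    using t unfolding of_real_eq_0_iff by linarith
  have lipschitz: "dist (f x) (f x') \<le> m * dist x x'" for x x'
  proof -
    let ?g = "k * (x - x') + (\<i> * complex_of_real t) *\<^sub>C (x - x')"
    have "f x - f x' = (- \<i> / complex_of_real (1 + t)) *\<^sub>C ?g"
      unfolding f_def scaleC_diff_right[symmetric]
      by (simp add: scaleC_diff_right right_diff_distrib algebra_simps)
    then have "dist (f x) (f x') = norm ?g / (1 + t)"
      using t by (simp add: dist_norm norm_scaleC norm_divide del: of_real_add)
    moreover have "(norm ?g)\<^sup>2 \<le> (sqrt (t + t\<^sup>2) * norm (x - x'))\<^sup>2"
      using norm_selfadjoint_plus_imaginary[OF assms, of "x - x'" t] t
      by (simp add: power_mult_distrib t_def)
    then have "norm ?g \<le> sqrt (t + t\<^sup>2) * norm (x - x')"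
      by (rule power2_le_imp_le) (use t in simp)
    ultimately show ?thesis
      using t by (simp add: m_def dist_norm divide_right_mono)
  qed
  have "f x = x \<longleftrightarrow> k * x - \<i> *\<^sub>C x = y" for x
  proof -
    let ?n = "\<i> * complex_of_real (1 + t)"
    let ?g = "k * x + (\<i> * complex_of_real t) *\<^sub>C x - y"
    have inv: "?n * (- \<i> / complex_of_real (1 + t)) = 1" "(- \<i> / complex_of_real (1 + t)) * ?n = 1"
      using t_nz by (simp_all del: of_real_add)
    have "?n *\<^sub>C f x = ?g" "(- \<i> / complex_of_real (1 + t)) *\<^sub>C ?n *\<^sub>C x = x"
      unfolding f_def scaleC_scaleC inv by simp_all
    then have "f x = x \<longleftrightarrow> ?g = ?n *\<^sub>C x"
      unfolding f_def by metis
    also have "?n *\<^sub>C x = \<i> *\<^sub>C x + (\<i> * complex_of_real t) *\<^sub>C x"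
      by (simp add: distrib_left scaleC_add_left)
    finally show ?thesis by (auto simp: algebra_simps)
  qed
  moreover have "\<exists>!x. f x = x"
    using banach_fix_type[OF m] lipschitz by blast
  ultimately show ?thesis by simp
qed

lemma ex1_one_plus_selfadjoint_square:
  fixes k y :: "'a::cstar_algebra"
  assumes "star k = k"
  shows "\<exists>!x. x + k * (k * x) = y"
proof -
  have factor: "k * (k * x + \<i> *\<^sub>C x) - \<i> *\<^sub>C (k * x + \<i> *\<^sub>C x) = x + k * (k * x)" for x
    by (simp add: distrib_left scaleC_add_right mult_scaleC_right scaleC_scaleC scaleC_minus_one)
  have "star (- k) = - k"
    using assms by (simp add: star_minus)
  \<comment> \<open>The factor \<open>k + \<i>\<close> is inverted through \<open>k + \<i> = - ((- k) - \<i>)\<close>.\<close>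
  have plus: "\<exists>!x. k * x + \<i> *\<^sub>C x = z" for z
  proof -
    have "(- k) * x - \<i> *\<^sub>C x = - z \<longleftrightarrow> k * x + \<i> *\<^sub>C x = z" for x
      by (metis (no_types) minus_add_distrib minus_mult_left neg_equal_iff_equal
          uminus_add_conv_diff add.commute)
    then show ?thesis
      using ex1_selfadjoint_minus_ii[OF \<open>star (- k) = - k\<close>, of "- z"] by simp
  qed
  show ?thesis
    using ex1_selfadjoint_minus_ii[OF assms, of y] plus factor by metis
qed

section \<open>Existence of the Moore-Penrose inverse\<close>

text \<open>
  The operator \<open>w = 1 - (e - e\<^sup>*)\<^sup>2\<close> commutes with \<open>e\<close> and \<open>e\<^sup>*\<close>, and \<open>w e = e e\<^sup>* e\<close>. Hence \<open>p\<close> with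
  \<open>w p = e e\<^sup>*\<close> inherits its properties from those of \<open>e e\<^sup>*\<close>, by injectivity of \<open>w\<close>.
\<close>

lemma idempotent_range_projection:
  fixes e :: "'a::cstar_algebra"
  assumes e: "e * e = e"
  obtains p where "star p = p" "e * p = p" "p * e = e"
proof -
  define h where "h = star e"
  have h: "h * h = h" "star h = e" "star e = h"
    using e star_mult[of e e] by (simp_all add: h_def star_star)
  note e' = e mult.assoc[of e e, unfolded e, symmetric]
  note h' = h mult.assoc[of h h, unfolded h(1), symmetric]
  define w where "w x = x - (e - h) * ((e - h) * x)" for x
  define k where "k = \<i> *\<^sub>C (e - h)"
  have "star k = k"
    using scaleC_scaleC[of \<i> "- 1" "h - e"]
    by (simp add: k_def star_scaleC star_diff h scaleC_minus_one)
  have w_k: "w x = x + k * (k * x)" for x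
    by (simp add: k_def w_def mult_scaleC_left mult_scaleC_right scaleC_scaleC scaleC_minus_one)
  have w_bij: "\<exists>!x. w x = y" for y
    unfolding w_k by (rule ex1_one_plus_selfadjoint_square[OF \<open>star k = k\<close>])
  have w_eq: "w x = x - e * x - h * x + e * (h * x) + h * (e * x)" for x
    by (simp add: w_def algebra_simps e' h')
  have w_cancel: "x = y" if "w x = w y" for x y
    using w_bij that by metis
  have w_e: "w (e * x) = e * w x" and w_mult: "w (x * y) = w x * y" for x y
    unfolding w_eq by (simp_all add: algebra_simps e' h')
  have w_diff: "w (x - y) = w x - w y" for x y
    unfolding w_eq by (simp add: algebra_simps)
  obtain p where p: "w p = e * h"
    using w_bij by blast
  have w_self: "w e = e * h * e"
    by (simp add: w_eq algebra_simps e' h')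
  have "e * p = p"
    by (rule w_cancel) (simp add: w_e p e')
  moreover have "p * e = e"
    by (rule w_cancel) (simp add: w_mult p w_self)
  moreover have "star p = p"
  proof -
    \<comment> \<open>\<open>w'\<close> is multiplication by \<open>1 - (e - e\<^sup>*)\<^sup>2\<close> on the right.\<close>
    define w' where "w' x = star (w (star x))" for x
    have w'_eq: "w' x = x - x * e - x * h + x * h * e + x * e * h" for x
      unfolding w'_def w_eq
      by (simp add: star_diff star_add star_mult star_star h algebra_simps)
    have commute: "w (w' x) = w' (w x)" for x
      unfolding w'_eq w_eq by (simp add: algebra_simps)
    have "w' (star p) = e * h"
      by (simp add: w'_def star_star p star_mult h)
    then have "w (w' (star p)) = w (e * h)" by simp
    also have "\<dots> = w' (e * h)"
      unfolding w'_eq w_eq by (simp add: algebra_simps e' h')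
    also have "\<dots> = w (w' p)"
      by (simp add: commute p)
    finally have "w' (star p) = w' p"
      by (rule w_cancel)
    then have "w p = w (star p)"
      unfolding w'_def by (metis star_star)
    then show ?thesis
      using w_cancel by metis
  qed
  ultimately show ?thesis using that by blast
qed

text \<open>
  With \<open>a a' a = a\<close>, both \<open>a a'\<close> and \<open>a' a\<close> are idempotent but perhaps not self-adjoint. Cutting
  \<open>a'\<close> down by a projection on each side turns these products into projections.
\<close>

lemma regular_element_has_mp_inverse:
  fixes a :: "'a::cstar_algebra"
  assumes "regular_element a"
  shows "\<exists>x. is_mp_inverse a x"
proof -
  obtain a' where a': "a * a' * a = a"
    using assms unfolding regular_element_def by metis
  have "(a * a') * (a * a') = a * a'"
    using a' by (metis mult.assoc)
  then obtain p where p: "star p = p" "a * a' * p = p" "p * (a * a') = a * a'"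
    using idempotent_range_projection by blast
  have idem: "star (a' * a) * star (a' * a) = star (a' * a)"
    using a' star_mult[of "a' * a" "a' * a"] by (simp add: mult.assoc)
  then obtain s where s: "star s = s" "star (a' * a) * s = s" "s * star (a' * a) = star (a' * a)"
    using idempotent_range_projection by blast
  have s': "s * (a' * a) = s" "(a' * a) * s = a' * a"
    using s by (metis star_mult star_star)+
  have pa: "p * a = a"
    using p(3) a' by (metis mult.assoc)
  have as: "a * s = a"
    using s'(2) a' by (metis mult.assoc)
  have ss: "s * s = s"
    using s' by (metis mult.assoc)
  define x where "x = s * a' * p"
  have ax: "a * x = p"
    using as p(2) by (simp add: x_def flip: mult.assoc)
  have xa: "x * a = s"
    using pa s'(1) by (simp add: x_def mult.assoc)
  have "x * a * x = x"
    unfolding xa using ss by (simp add: x_def flip: mult.assoc)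
  then have "is_mp_inverse a x"
    unfolding is_mp_inverse_def using ax xa pa p(1) s(1) by simp
  then show ?thesis ..
qed

lemma is_mp_inverse_mp_inverse:
  "regular_element a \<Longrightarrow> is_mp_inverse a (mp_inverse a)"
  using regular_element_has_mp_inverse mp_inverse_eqI by metis

lemma is_mp_inverse_sym: "is_mp_inverse a x \<Longrightarrow> is_mp_inverse x a"
  unfolding is_mp_inverse_def by auto

lemma is_mp_inverseD:
  fixes a x :: "'a::cstar_algebra"
  assumes "is_mp_inverse a x"
  shows "a * (x * a) = a" "x * (a * x) = x"
    and "star x * star a = a * x" "star a * star x = x * a"
    and "star a * (a * x) = star a" "x * (star x * star a) = x"
    and "star x * (x * a) = star x" "a * (star a * star x) = a"
proof -
  show *: "a * (x * a) = a" "x * (a * x) = x"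
    and **: "star x * star a = a * x" "star a * star x = x * a"
    using assms unfolding is_mp_inverse_def by (simp_all add: mult.assoc star_mult)
  show "x * (star x * star a) = x" "a * (star a * star x) = a"
    by (simp_all add: * **)
  show "star a * (a * x) = star a" "star x * (x * a) = star x"
    using assms unfolding is_mp_inverse_def by (metis star_mult)+
qed

lemma is_mp_inverse_gram:
  fixes a x :: "'a::cstar_algebra"
  assumes "is_mp_inverse a x"
  shows "is_mp_inverse (x * star x) (star a * a)"
    and "x * star x * (star a * a) = x * a"
proof -
  note D = is_mp_inverseD[OF assms]
  show 1: "x * star x * (star a * a) = x * a"
    using D(6) by (metis mult.assoc)
  have 2: "star a * a * (x * star x) = x * a"
    using D(4,5) by (metis mult.assoc)
  show "is_mp_inverse (x * star x) (star a * a)"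
    unfolding is_mp_inverse_def 1 2
    using D by (simp add: star_mult) (metis mult.assoc)
qed

section \<open>Greville's condition\<close>

text \<open>
  The C*-identity is applied to \<open>(1 - s) p s\<close>.
\<close>

lemma projections_commute_if_compression_idempotent:
  fixes s p :: "'a::cstar_algebra"
  assumes s: "star s = s" "s * s = s" and p: "star p = p" "p * p = p"
    and idem: "s * p * s * (s * p * s) = s * p * s"
  shows "s * p = p * s"
proof -
  let ?v = "p * s - s * p * s"
  have v: "star ?v = s * p - s * p * s"
    by (simp add: star_diff star_mult s p mult.assoc)
  have "star ?v * ?v = s * (p * p) * s - s * p * s * p * s - s * p * s * p * s
      + s * p * (s * s) * p * s"
    unfolding v by (simp add: algebra_simps)
  also have "\<dots> = 0"
    using idem by (simp add: s p mult.assoc) (metis mult.assoc s(2) diff_self)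
  finally have "p * s = s * p * s"
    by (simp add: star_mult_self_eq_zero_iff)
  then show ?thesis
    by (metis star_mult s(1) p(1) mult.assoc)
qed

context
  fixes a x b y :: "'a::cstar_algebra"
  assumes ax: "is_mp_inverse a x" and by_: "is_mp_inverse b y"
begin

text \<open>
  The projections \<open>s = x a\<close> and \<open>p = b y\<close>, together with \<open>c = a\<^sup>* a\<close>, which has \<open>s\<close> as unit and
  \<open>x x\<^sup>*\<close> as inverse relative to \<open>s\<close>, and \<open>d = y\<^sup>* y\<close>, which has \<open>p\<close> as unit.
\<close>

private definition "s = x * a"
private definition "p = b * y"
private definition "c = star a * a"
private definition "d = star y * y"

private lemma projections:
  "star s = s" "s * s = s" "star p = p" "p * p = p"
  using is_mp_inverseD[OF ax] is_mp_inverseD[OF by_]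
  by (simp_all add: s_def p_def star_mult mult.assoc)

private lemma units:
  "star c = c" "s * c = c" "c * s = c" "star d = d" "p * d = d" "d * p = d"
proof -
  note A = is_mp_inverseD[OF ax] and B = is_mp_inverseD[OF by_]
  show "star c = c" "star d = d"
    by (simp_all add: c_def d_def star_mult star_star)
  show cs: "c * s = c" and dp: "d * p = d"
    using A B by (simp_all add: c_def d_def s_def p_def mult.assoc)
  show "s * c = c" "p * d = d"
    using arg_cong[OF cs, of star] arg_cong[OF dp, of star] projections
    by (simp_all add: star_mult \<open>star c = c\<close> \<open>star d = d\<close>)
qed

private lemma cancel_c: "c * u = c * v \<Longrightarrow> s * u = s * v"
  using is_mp_inverse_gram(2)[OF ax] unfolding s_def c_def by (metis mult.assoc)

text \<open>
  Commuting with \<open>c\<close> entails commuting with its relative unit \<open>s\<close>.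
\<close>

private lemma commute_c_imp_commute_s:
  assumes "c * p = p * c"
  shows "s * p = p * s"
proof -
  have "c * (p * s) = c * p"
    using assms units by (metis mult.assoc)
  then have "s * p * s = s * p"
    using cancel_c by (metis mult.assoc)
  then show ?thesis
    by (metis star_mult projections(1,3) mult.assoc)
qed

text \<open>
  Given the commutation relations, \<open>a p x\<close> and \<open>y s b\<close> are self-adjoint: \<open>a p x\<close> equals
  \<open>x\<^sup>* (c p) x\<close> and its adjoint \<open>x\<^sup>* p a\<^sup>*\<close> equals \<open>x\<^sup>* (p c) x\<close>; similarly for \<open>y s b = b\<^sup>* (d s) b\<close>.
  Conversely, self-adjointness of \<open>a p x\<close> and \<open>y s b\<close> says that \<open>c\<close> and \<open>d\<close> commute with \<open>p\<close> and \<open>s\<close> up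
  to the projections in between, which can be moved away once \<open>s p = p s\<close>.
\<close>

private lemma reverse_order_iff_commute:
  "is_mp_inverse (a * b) (y * x) \<longleftrightarrow> c * p = p * c \<and> d * s = s * d"
proof
  note A = is_mp_inverseD[OF ax] and B = is_mp_inverseD[OF by_]
  assume "is_mp_inverse (a * b) (y * x)"
  then have 1: "a * p * s * b = a * b" and 2: "star (a * p * x) = a * p * x"
    and 3: "star (y * s * b) = y * s * b"
    unfolding is_mp_inverse_def by (simp_all add: p_def s_def mult.assoc)
  have "s * p * s * p = s * p"
    using arg_cong[OF 1, of "\<lambda>t. x * t * y"] by (simp add: p_def s_def mult.assoc)
  then have sp: "s * p = p * s"
    by (intro projections_commute_if_compression_idempotent projections)
      (metis mult.assoc projections(2))
  have "star x * p * star a = a * p * x"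
    using 2 by (simp add: star_mult projections mult.assoc)
  from arg_cong[OF this, of "\<lambda>t. star a * t * a"] have "s * p * c = c * p * s"
    using A(4) by (simp add: s_def c_def mult.assoc) (metis mult.assoc)
  then have "c * p = p * c"
    by (metis mult.assoc sp units(2,3))
  moreover have "star b * s * star y = y * s * b"
    using 3 by (simp add: star_mult projections mult.assoc)
  from arg_cong[OF this, of "\<lambda>t. star y * t * y"] have "p * s * d = d * s * p"
    using B(3) by (simp add: p_def d_def mult.assoc) (metis mult.assoc)
  then have "d * s = s * d"
    by (metis mult.assoc sp units(5,6))
  ultimately show "c * p = p * c \<and> d * s = s * d" ..
next
  note A = is_mp_inverseD[OF ax] and B = is_mp_inverseD[OF by_]
  assume comm: "c * p = p * c \<and> d * s = s * d"
  then have sp: "s * p = p * s"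
    using commute_c_imp_commute_s by blast
  have "a * p * x = star x * (c * p) * x"
    using A(1,3) unfolding c_def by (metis mult.assoc)
  also have "\<dots> = star x * (p * c) * x"
    using comm by simp
  also have "\<dots> = star x * p * star a"
    using A(5) by (simp add: c_def mult.assoc)
  also have "\<dots> = star (a * p * x)"
    by (simp add: star_mult projections mult.assoc)
  finally have 1: "star (a * p * x) = a * p * x" by simp
  have "y * s * b = star b * (d * s) * b"
    using B(2,4) unfolding d_def by (metis mult.assoc)
  also have "\<dots> = star b * (s * d) * b"
    using comm by simp
  also have "\<dots> = star b * s * star y"
    using B(7) by (simp add: d_def mult.assoc)
  also have "\<dots> = star (y * s * b)"
    by (simp add: star_mult projections mult.assoc)
  finally have 2: "star (y * s * b) = y * s * b" by simp
  have "a * (p * s) * b = a * b"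
    unfolding sp[symmetric] using A(1) B(1) unfolding s_def p_def by (metis mult.assoc)
  moreover have "y * (s * p) * x = y * x"
    unfolding sp using A(2) B(2) unfolding s_def p_def by (metis mult.assoc)
  ultimately show "is_mp_inverse (a * b) (y * x)"
    unfolding is_mp_inverse_def using 1 2 by (simp add: s_def p_def mult.assoc)
qed

text \<open>
  The first equation alone makes \<open>s\<close> and \<open>p\<close> commute; afterwards the equations reduce to
  \<open>p c p = p c\<close> and \<open>s d s = d s\<close>, whose left-hand sides are self-adjoint.
\<close>

private lemma compressions_iff_commute:
  "p * c * p * s = p * c \<and> p * s * d * s = d * s \<longleftrightarrow> c * p = p * c \<and> d * s = s * d"
proof
  assume "p * c * p * s = p * c \<and> p * s * d * s = d * s"
  then have 1: "p * c * p * s = p * c" and 2: "p * s * d * s = d * s" by auto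
  have adj: "s * p * c * p = c * p"
    using arg_cong[OF 1, of star] by (simp add: star_mult projections units mult.assoc)
  define z where "z = s * p * s"
  have z: "star z = z" "s * z = z" "c * z = c * p * s"
    unfolding z_def using projections units
    by (simp_all add: star_mult mult.assoc) (metis mult.assoc)+
  have zc: "z * c = s * p * c"
    unfolding z_def using units by (simp add: mult.assoc)
  have zcz: "z * c * z = c * z"
    using z(3) zc adj by (metis mult.assoc units(3) z_def)
  have "z * c * z = z * c"
    using arg_cong[OF zcz, of star] by (simp add: star_mult z(1) units(1) flip: mult.assoc)
  then have "c * (z * z) = c * z"
    using zcz by (metis mult.assoc)
  then have "z * z = z"
    using cancel_c z(2) by (metis mult.assoc)
  then have sp: "s * p = p * s"
    unfolding z_def by (intro projections_commute_if_compression_idempotent projections)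
  have "p * c * p = c * p"
    using adj sp by (metis mult.assoc units(2))
  then have "c * p = p * c"
    by (metis mult.assoc star_mult projections(3) units(1))
  moreover have "s * d * s = d * s"
    using 2 sp by (metis mult.assoc units(5))
  then have "d * s = s * d"
    by (metis mult.assoc star_mult projections(1) units(4))
  ultimately show "c * p = p * c \<and> d * s = s * d" ..
next
  assume comm: "c * p = p * c \<and> d * s = s * d"
  then have sp: "s * p = p * s"
    using commute_c_imp_commute_s by blast
  show "p * c * p * s = p * c \<and> p * s * d * s = d * s"
    using comm sp projections units by (metis mult.assoc)
qed

private lemma sandwich_zero_iff:
  "star b * t * x = 0 \<longleftrightarrow> p * t * s = 0"
proof -
  note A = is_mp_inverseD[OF ax] and B = is_mp_inverseD[OF by_]
  have "p * t * s = star y * (star b * t * x) * a"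
    using B(3) by (simp add: p_def s_def flip: mult.assoc)
  moreover have "star b * t * x = star b * (p * t * s) * x"
    using B(5) A(2) unfolding p_def s_def by (metis mult.assoc)
  ultimately show ?thesis by auto
qed

private lemma sandwiches_iff_compressions:
  "star b * (c * p - p * c) * x = 0 \<longleftrightarrow> p * c * p * s = p * c"
  "star b * (s * d - d * s) * x = 0 \<longleftrightarrow> p * s * d * s = d * s"
proof -
  have "p * (c * p - p * c) * s = p * c * p * s - p * c"
    using projections units by (simp add: algebra_simps) (metis mult.assoc)
  then show "star b * (c * p - p * c) * x = 0 \<longleftrightarrow> p * c * p * s = p * c"
    by (simp add: sandwich_zero_iff)
  have "p * (s * d - d * s) * s = p * s * d * s - d * s"
    using projections units by (simp add: algebra_simps) (metis mult.assoc)
  then show "star b * (s * d - d * s) * x = 0 \<longleftrightarrow> p * s * d * s = d * s"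
    by (simp add: sandwich_zero_iff)
qed

lemmas reverse_order_law_equivalences =
  reverse_order_iff_commute[unfolded s_def p_def c_def d_def]
  compressions_iff_commute[unfolded s_def p_def c_def d_def]
  sandwiches_iff_compressions[unfolded s_def p_def c_def d_def]

end

section \<open>The reverse order law\<close>

theorem theorem3p3:
  fixes a b p q r s :: "'a::cstar_algebra"
  assumes "regular_element a" and "regular_element b" and "regular_element (a * b)"
    and "p = b * mp_inverse b"
    and "q = mp_inverse a * star (mp_inverse a)"
    and "r = b * star b"
    and "s = mp_inverse a * a"
  shows "(mp_inverse (a * b) = mp_inverse b * mp_inverse a
          \<longleftrightarrow> star b * (mp_inverse q * p - p * mp_inverse q) * mp_inverse a = 0
            \<and> star b * (s * mp_inverse r - mp_inverse r * s) * mp_inverse a = 0)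
       \<and> (star b * (mp_inverse q * p - p * mp_inverse q) * mp_inverse a = 0
            \<and> star b * (s * mp_inverse r - mp_inverse r * s) * mp_inverse a = 0
          \<longleftrightarrow> p * mp_inverse q * p * s = p * mp_inverse q
            \<and> p * s * mp_inverse r * s = mp_inverse r * s)"
proof -
  have a: "is_mp_inverse a (mp_inverse a)" and b: "is_mp_inverse b (mp_inverse b)"
    using assms(1,2) by (simp_all add: is_mp_inverse_mp_inverse)
  have q: "mp_inverse q = star a * a"
    unfolding assms(5) by (rule mp_inverse_eqI[OF is_mp_inverse_gram(1)[OF a]])
  have r: "mp_inverse r = star (mp_inverse b) * mp_inverse b"
    unfolding assms(6) by (rule mp_inverse_eqI[OF is_mp_inverse_gram(1)[OF is_mp_inverse_sym[OF b]]])
  have i: "mp_inverse (a * b) = mp_inverse b * mp_inverse a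
      \<longleftrightarrow> is_mp_inverse (a * b) (mp_inverse b * mp_inverse a)"
    using is_mp_inverse_mp_inverse[OF assms(3)] mp_inverse_eqI by metis
  show ?thesis
    unfolding i q r assms(4,7) reverse_order_law_equivalences[OF a b] by simp
qed

end
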